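(* In $\mathbb{Q}[[x]]$, $$\sum_{n\ge0}E_nx^n=b_0+\cfrac{a_1}{b_1+\cfrac{a_2}{b_2+\cfrac{a_3}{b_3+\cdots}}},$$ where $a_1=1$, $b_0=0$, and $a_{6k}=-2kx$, $b_{6k}=1$, $a_{6k+1}=-2kx$ (for $k\ge1$); $b_{6k+1}=1$, $a_{6k+2}=-(4k+1)x$, $b_{6k+2}=1$, $a_{6k+3}=-(4k+1)(2k+1)x^2$, $b_{6k+3}=1-2(2k+1)x$, $a_{6k+4}=-(4k+3)(2k+1)x^2$, $b_{6k+4}=1$, $a_{6k+5}=-(4k+3)x$, $b_{6k+5}=1$ (for $k\ge0$). Explicitly it begins $\cfrac{1}{1-\cfrac{x}{1-\cfrac{x^2}{1-2x-\cfrac{3x^2}{1-\cfrac{3x}{1-\cfrac{2x}{1-\cfrac{2x}{1-\cfrac{5x}{1-\cfrac{15x^2}{1-6x-\cdots}}}}}}}}}$.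
   Context: The Euler numbers $E_n$ are defined by $\tan(x)+\sec(x)=\sum_{n\ge0}E_nx^n/n!$. A continued fraction $b_0+\cfrac{a_1}{b_1+\cfrac{a_2}{b_2+\cdots}}$ with polynomial entries denotes the formal power series in $x$ that is the $x$-adic limit of its convergents. *)

theory Defs
  imports "HOL-Computational_Algebra.Computational_Algebra"
begin

definition euler_number :: "nat \<Rightarrow> rat" where
  "euler_number n = fact n * fps_nth (fps_tan 1 + 1 / fps_cos 1) n"

lemma euler_number_egf:
  "fps_tan 1 + 1 / fps_cos 1 = Abs_fps (\<lambda>n. euler_number n / fact n)"
  by (rule fps_ext) (simp add: euler_number_def)

text \<open>
  \<open>cfrac_seg a b i n\<close> is the finite continued fraction
  \<open>b i + a (i+1) / (b (i+1) + a (i+2) / (\<dots> + a (i+n) / b (i+n)))\<close>;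
  the \<open>n\<close>-th convergent is the case \<open>i = 0\<close>.
\<close>

fun cfrac_seg :: "(nat \<Rightarrow> rat poly) \<Rightarrow> (nat \<Rightarrow> rat poly) \<Rightarrow> nat \<Rightarrow> nat \<Rightarrow> rat fps" where
  "cfrac_seg a b i 0 = fps_of_poly (b i)"
| "cfrac_seg a b i (Suc n) =
     fps_of_poly (b i) + fps_of_poly (a (Suc i)) / cfrac_seg a b (Suc i) n"

text \<open>
  The division of \<open>rat fps\<close> is total. Requiring every denominator that occurs in a
  convergent to be a unit makes each quotient an actual quotient, equal to the one in the
  field of rational functions. The topology of \<open>rat fps\<close> is the \<open>X\<close>-adic one.
\<close>

definition has_cfrac :: "rat fps \<Rightarrow> (nat \<Rightarrow> rat poly) \<Rightarrow> (nat \<Rightarrow> rat poly) \<Rightarrow> bool" where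
  "has_cfrac f a b \<longleftrightarrow>
     (\<forall>i n. 1 \<le> i \<longrightarrow> cfrac_seg a b i n dvd 1) \<and>
     (\<lambda>n. cfrac_seg a b 0 n) \<longlonglongrightarrow> f"

abbreviation X :: "rat poly" where
  "X \<equiv> [:0, 1:]"

end

theory Submission
  imports Defs
begin

text \<open>
  Put \<open>u = sec x + tan x - 1\<close>, so that \<open>u' = 1 + u + u\<^sup>2 / 2\<close>. Replacing \<open>x\<^sup>n / n!\<close> by \<open>x\<^sup>n\<close>
  in \<open>u\<^sup>n / n!\<close> gives a series \<open>x\<^sup>n p\<^sub>n\<close> with \<open>p\<^sub>n\<close> of constant term 1, and the differential
  equation becomes
  \<open>p\<^sub>n\<^sub>+\<^sub>1 = p\<^sub>n + (n+1) x p\<^sub>n\<^sub>+\<^sub>1 + (n+1)(n+2)/2 x\<^sup>2 p\<^sub>n\<^sub>+\<^sub>2\<close>, while \<open>p\<^sub>0 + x p\<^sub>1 = \<Sum> E\<^sub>n x\<^sup>n\<close>.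
  With \<open>n = 4k\<close>, the six series
  \<open>p\<^sub>n, p\<^sub>n + (n+1) x p\<^sub>n\<^sub>+\<^sub>1, p\<^sub>n\<^sub>+\<^sub>1, p\<^sub>n\<^sub>+\<^sub>2, p\<^sub>n\<^sub>+\<^sub>3, p\<^sub>n\<^sub>+\<^sub>3 + (n+4)/2 x p\<^sub>n\<^sub>+\<^sub>4\<close>
  are \<open>V (6k), \<dots>, V (6k+5)\<close> for a solution \<open>V\<close> of the three-term recurrence
  \<open>V i = b (i+1) V (i+1) + a (i+2) V (i+2)\<close> of the continued fraction, whose value is
  therefore \<open>V 1 / V 0\<close>.
\<close>

section \<open>X-adic convergence of continued fractions\<close>

lemma fps_X_dvd_iff:
  fixes f :: "'a::comm_ring_1 fps"
  shows "fps_X dvd f \<longleftrightarrow> f $ 0 = 0"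
proof
  assume "f $ 0 = 0"
  then have "f = fps_X * fps_shift 1 f"
    by (intro fps_ext) simp
  then show "fps_X dvd f" ..
qed auto

lemma fps_X_power_dvd_imp_nth_eq_0:
  fixes f :: "'a::comm_ring_1 fps"
  assumes "fps_X ^ n dvd f" "m < n"
  shows "f $ m = 0"
  using assms by (auto simp: fps_X_power_mult_nth elim!: dvdE)

lemma fps_divide_nth_0_eq_1:
  fixes f g :: "'a::field fps"
  assumes "f $ 0 = 1" "g $ 0 = 1"
  shows "(f / g) $ 0 = 1"
  using assms by (simp add: fps_divide_unit)

text \<open>Dividing the recurrence by \<open>V (Suc i)\<close> shows that the ratios of consecutive
  \<open>V\<close> satisfy the relation between successive tails of the continued fraction. Every
  partial numerator from the second on is divisible by \<open>fps_X\<close>, so each level of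
  nesting gains one order of accuracy.\<close>

lemma has_cfrac_three_term:
  fixes V :: "nat \<Rightarrow> rat fps"
  assumes rec: "\<And>i. V i = fps_of_poly (b (Suc i)) * V (Suc i)
                          + fps_of_poly (a (Suc (Suc i))) * V (Suc (Suc i))"
    and V0: "\<And>i. V i $ 0 = 1"
    and a0: "\<And>i. coeff (a (Suc (Suc i))) 0 = 0"
  shows "has_cfrac (fps_of_poly (b 0) + fps_of_poly (a 1) * (V 1 / V 0)) a b"
proof -
  \<comment> \<open>Forced by comparing constant terms in the recurrence.\<close>
  have b0: "coeff (b (Suc i)) 0 = 1" for i
    using arg_cong[OF rec[of i], of "\<lambda>f. f $ 0"] by (simp add: V0 a0)
  \<comment> \<open>For \<open>i \<ge> 1\<close> this is the value of the infinite tail that starts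
    at \<open>b i\<close>.\<close>
  define F where "F i = V (i - 1) / V i" for i
  have F0: "F i $ 0 = 1" for i
    by (simp add: F_def V0 fps_divide_nth_0_eq_1)
  have nz: "V i \<noteq> 0" for i
    using V0[of i] by auto
  have F_rec: "F (Suc i) = fps_of_poly (b (Suc i)) + fps_of_poly (a (Suc (Suc i))) / F (Suc (Suc i))"
    for i
  proof -
    have "fps_of_poly (a (Suc (Suc i))) / F (Suc (Suc i))
        = fps_of_poly (a (Suc (Suc i))) * V (Suc (Suc i)) / V (Suc i)"
      unfolding F_def by (simp add: V0 fps_divide_unit fps_inverse_mult)
    moreover have "fps_of_poly (b (Suc i)) * V (Suc i) / V (Suc i) = fps_of_poly (b (Suc i))"
      by (simp add: nz)
    ultimately show ?thesis
      unfolding F_def using rec[of i] by (simp add: div_add V0)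
  qed
  have seg0: "cfrac_seg a b (Suc i) n $ 0 = 1" for i n
  proof (induction n arbitrary: i)
    case (Suc n)
    show ?case
      by (simp add: b0 a0 Suc.IH fps_divide_unit)
  qed (simp add: b0)
  have recip_diff: "c / f - c / g = c * (g - f) * inverse (f * g)"
    if "f $ 0 = 1" "g $ 0 = 1" for c f g :: "rat fps"
  proof -
    have fg: "f * inverse f = 1" "g * inverse g = 1"
      using that by (simp_all add: inverse_mult_eq_1')
    have "c * (g - f) * (inverse f * inverse g)
        = c * inverse f * (g * inverse g) - c * inverse g * (f * inverse f)"
      by (simp add: algebra_simps)
    then show ?thesis
      using that by (simp add: fg fps_divide_unit fps_inverse_mult)
  qed
  \<comment> \<open>Since 1/f - 1/g = (g - f)/(fg), the error passes from one tail to the preceding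
    one with an extra factor \<open>a (Suc (Suc i))\<close>, which \<open>fps_X\<close>
    divides.\<close>
  have approx: "fps_X ^ Suc n dvd cfrac_seg a b (Suc i) n - F (Suc i)" for i n
  proof (induction n arbitrary: i)
    case 0
    have "(cfrac_seg a b (Suc i) 0 - F (Suc i)) $ 0 = 0"
      by (simp add: b0 F0)
    then show ?case
      by (simp add: fps_X_dvd_iff)
  next
    case (Suc n)
    have "cfrac_seg a b (Suc i) (Suc n) - F (Suc i)
        = fps_of_poly (a (Suc (Suc i))) * (F (Suc (Suc i)) - cfrac_seg a b (Suc (Suc i)) n)
          * inverse (cfrac_seg a b (Suc (Suc i)) n * F (Suc (Suc i)))"
      by (subst F_rec) (simp add: recip_diff[OF seg0 F0, symmetric])
    moreover have "fps_X dvd fps_of_poly (a (Suc (Suc i)))"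
      by (simp add: fps_X_dvd_iff a0)
    moreover have "fps_X ^ Suc n dvd F (Suc (Suc i)) - cfrac_seg a b (Suc (Suc i)) n"
      using Suc.IH dvd_diff_commute by blast
    ultimately show ?case
      by (metis dvd_mult2 mult_dvd_mono power_Suc)
  qed
  \<comment> \<open>\<open>a 1\<close> need not be divisible by \<open>fps_X\<close>, so the
    outermost level gains nothing; agreement in degrees below \<open>n\<close> remains.\<close>
  have "(\<lambda>n. cfrac_seg a b 0 n) \<longlonglongrightarrow> fps_of_poly (b 0) + fps_of_poly (a 1) * (V 1 / V 0)"
  proof (rule tendsto_fpsI)
    fix m
    have "cfrac_seg a b 0 n $ m = (fps_of_poly (b 0) + fps_of_poly (a 1) * (V 1 / V 0)) $ m"
      if n: "n > m" for n
    proof -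
      obtain l where l: "n = Suc l" "m \<le> l"
        using n by (cases n) auto
      have "fps_of_poly (a 1) * (V 1 / V 0) = fps_of_poly (a 1) / F 1"
        by (simp add: F_def V0 fps_divide_unit fps_inverse_mult)
      then have "cfrac_seg a b 0 n - (fps_of_poly (b 0) + fps_of_poly (a 1) * (V 1 / V 0))
          = fps_of_poly (a 1) * (F 1 - cfrac_seg a b 1 l) * inverse (cfrac_seg a b 1 l * F 1)"
        using recip_diff[OF seg0 F0, of _ 0 l 1] l by simp
      moreover have "fps_X ^ Suc l dvd F 1 - cfrac_seg a b 1 l"
        using approx[of l 0] dvd_diff_commute by fastforce
      ultimately have "fps_X ^ Suc l dvd
          cfrac_seg a b 0 n - (fps_of_poly (b 0) + fps_of_poly (a 1) * (V 1 / V 0))"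
        by (metis dvd_mult dvd_mult2)
      then have "(cfrac_seg a b 0 n - (fps_of_poly (b 0) + fps_of_poly (a 1) * (V 1 / V 0))) $ m = 0"
        using l by (intro fps_X_power_dvd_imp_nth_eq_0[where n = "Suc l"]) auto
      then show ?thesis
        by simp
    qed
    then show "\<forall>\<^sub>F n in sequentially. cfrac_seg a b 0 n $ m =
        (fps_of_poly (b 0) + fps_of_poly (a 1) * (V 1 / V 0)) $ m"
      by (rule eventually_mono[OF eventually_gt_at_top[of m]])
  qed
  moreover have "cfrac_seg a b i n dvd 1" if "1 \<le> i" for i n
    using that seg0[of "i - 1" n] by simp
  ultimately show ?thesis
    unfolding has_cfrac_def by blast
qed

section \<open>Powers of a series and the differential equation\<close>

text \<open>
  The series \<open>p\<^sub>n\<close> above. When \<open>u $ 0 = 0\<close>, the shift by \<open>n\<close> drops only zero coefficients.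
\<close>

definition ogf_power :: "'a::field_char_0 fps \<Rightarrow> nat \<Rightarrow> 'a fps" where
  "ogf_power u n = Abs_fps (\<lambda>j. fact (n + j) / fact n * (u ^ n) $ (n + j))"

lemma ogf_power_0 [simp]: "ogf_power u 0 = 1"
  by (rule fps_ext) (simp add: ogf_power_def)

lemma ogf_power_nth_0:
  assumes "u $ 0 = 0" "u $ 1 = 1"
  shows "ogf_power u n $ 0 = 1"
  using assms startsby_zero_power_nth_same[OF assms(1), of n] by (simp add: ogf_power_def)

text \<open>Coefficient comparison in the derivative of \<open>u ^ Suc n\<close>, with
  \<open>u'\<close> replaced by its quadratic expression. The number \<open>c\<close> is
  (n+1)(n+2)/2, kept as a natural number.\<close>

lemma ogf_power_recurrence:
  fixes u :: "'a::field_char_0 fps"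
  assumes u0: "u $ 0 = 0"
    and u': "fps_deriv u = 1 + u + fps_const (1 / 2) * u\<^sup>2"
    and c: "2 * c = (n + 1) * (n + 2)"
  shows "ogf_power u (Suc n) = ogf_power u n + of_nat (n + 1) * fps_X * ogf_power u (Suc n)
           + of_nat c * fps_X\<^sup>2 * ogf_power u (n + 2)"
proof (rule fps_ext)
  fix j
  have low: "(u ^ m) $ i = 0" if "i < m" for i m
    using startsby_zero_power_prefix[OF u0] that by simp
  have "fps_deriv (u ^ Suc n) = of_nat (Suc n) * (u ^ n + u ^ Suc n + fps_const (1 / 2) * u ^ (n + 2))"
    unfolding fps_deriv_power u' by (simp add: algebra_simps power2_eq_square flip: fps_of_nat)
  then have "fps_deriv (u ^ Suc n) $ (n + j)
      = of_nat (Suc n) * ((u ^ n) $ (n + j) + (u ^ Suc n) $ (n + j) + (u ^ (n + 2)) $ (n + j) / 2)"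
    by (simp flip: fps_of_nat del: of_nat_Suc power_Suc)
  then have "of_nat (Suc (n + j)) * (u ^ Suc n) $ Suc (n + j)
      = of_nat (Suc n) * ((u ^ n) $ (n + j) + (u ^ Suc n) $ (n + j) + (u ^ (n + 2)) $ (n + j) / 2)"
    by (simp del: power_Suc of_nat_Suc)
  then have "ogf_power u (Suc n) $ j
      = fact (n + j) / fact n * ((u ^ n) $ (n + j) + (u ^ Suc n) $ (n + j) + (u ^ (n + 2)) $ (n + j) / 2)"
    by (simp add: ogf_power_def field_simps del: power_Suc of_nat_Suc)
  \<comment> \<open>At \<open>j = 0\<close> both sides vanish, the right one because
    \<open>u ^ Suc n\<close> starts in degree \<open>n + 1\<close>.\<close>
  moreover have "(of_nat (n + 1) * fps_X * ogf_power u (Suc n)) $ j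
      = fact (n + j) / fact n * (u ^ Suc n) $ (n + j)"
    using low[of n "Suc n"]
    by (cases j) (simp_all add: ogf_power_def mult.assoc field_simps del: power_Suc of_nat_Suc flip: fps_of_nat)
  moreover have "(of_nat c * fps_X\<^sup>2 * ogf_power u (n + 2)) $ j
      = fact (n + j) / fact n * ((u ^ (n + 2)) $ (n + j) / 2)"
  proof (cases "j < 2")
    case True
    then show ?thesis
      using low[of "n + j" "n + 2"]
      by (simp add: mult.assoc fps_X_power_mult_nth del: power_Suc flip: fps_of_nat)
  next
    case False
    then obtain i where i: "j = i + 2"
      by (metis le_add_diff_inverse2 not_less)
    have "fact (n + 2) = (2 * c) * (fact n :: nat)"
      unfolding c by (simp add: algebra_simps)
    then have "fact (n + 2) = of_nat (2 * c) * (fact n :: 'a)"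
      by (metis of_nat_fact of_nat_mult)
    moreover have "c \<noteq> 0"
      using c by auto
    ultimately have "of_nat c * (fact (n + 2 + i) / fact (n + 2) * x) = fact (n + 2 + i) / fact n * (x / 2)"
      for x :: 'a
      by (simp add: field_simps del: fact_Suc)
    then show ?thesis
      by (simp add: i ogf_power_def mult.assoc fps_X_power_mult_nth add_ac
               del: power_Suc fact_Suc flip: fps_of_nat)
  qed
  ultimately show "ogf_power u (Suc n) $ j = (ogf_power u n
      + of_nat (n + 1) * fps_X * ogf_power u (Suc n) + of_nat c * fps_X\<^sup>2 * ogf_power u (n + 2)) $ j"
    by (simp add: ogf_power_def distrib_left del: power_Suc of_nat_Suc of_nat_add)
qed

text \<open>Clearing denominators gives S cos = 1 + sin; with its derivative and sin^2 + cos^2 = 1,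
  the claim follows after multiplication by cos^2, which cancels.\<close>

lemma fps_deriv_sec_add_tan:
  fixes S :: "'a::field_char_0 fps"
  defines "S \<equiv> fps_tan 1 + 1 / fps_cos 1"
  shows "2 * fps_deriv S = 1 + S\<^sup>2"
proof -
  let ?s = "fps_sin 1 :: 'a fps" and ?c = "fps_cos 1 :: 'a fps"
  have c0: "?c $ 0 \<noteq> 0"
    by simp
  then have nz: "?c \<noteq> 0"
    by (metis fps_zero_nth)
  have Sc: "S * ?c = 1 + ?s"
    using c0 by (simp add: S_def fps_tan_def fps_divide_unit distrib_right mult.assoc inverse_mult_eq_1)
  have pyth: "?c\<^sup>2 + ?s\<^sup>2 = 1"
    by (rule fps_sin_cos_sum_of_squares)
  have "fps_deriv (S * ?c) = fps_deriv (1 + ?s)"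
    by (simp add: Sc)
  then have D: "fps_deriv S * ?c = ?c + S * ?s"
    by (simp add: fps_sin_deriv fps_cos_deriv algebra_simps flip: fps_const_neg)
  have "(2 * fps_deriv S - (1 + S\<^sup>2)) * ?c\<^sup>2 = 0"
    using Sc pyth D by algebra
  then show ?thesis
    using nz by simp
qed

section \<open>The continued fraction of the Euler numbers\<close>

theorem theorem4p3:
  fixes a b :: "nat \<Rightarrow> rat poly"
  assumes "a 1 = 1" and "b 0 = 0"
    and "\<And>k. k \<ge> 1 \<Longrightarrow> a (6*k) = - of_nat (2*k) * X"
    and "\<And>k. k \<ge> 1 \<Longrightarrow> b (6*k) = 1"
    and "\<And>k. k \<ge> 1 \<Longrightarrow> a (6*k+1) = - of_nat (2*k) * X"
    and "\<And>k. b (6*k+1) = 1"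
    and "\<And>k. a (6*k+2) = - of_nat (4*k+1) * X"
    and "\<And>k. b (6*k+2) = 1"
    and "\<And>k. a (6*k+3) = - of_nat ((4*k+1) * (2*k+1)) * X^2"
    and "\<And>k. b (6*k+3) = 1 - of_nat (2 * (2*k+1)) * X"
    and "\<And>k. a (6*k+4) = - of_nat ((4*k+3) * (2*k+1)) * X^2"
    and "\<And>k. b (6*k+4) = 1"
    and "\<And>k. a (6*k+5) = - of_nat (4*k+3) * X"
    and "\<And>k. b (6*k+5) = 1"
  shows "has_cfrac (Abs_fps euler_number) a b \<and>
    map a [1..<10] = [1, - X, - (X^2), - 3 * X^2, - 3 * X, - 2 * X, - 2 * X, - 5 * X, - 15 * X^2] \<and>
    map b [0..<10] = [0, 1, 1, 1 - 2 * X, 1, 1, 1, 1, 1, 1 - 6 * X]"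
proof (intro conjI)
  define u :: "rat fps" where "u = fps_tan 1 + 1 / fps_cos 1 - 1"
  define p where "p = ogf_power u"
  have u0: "u $ 0 = 0"
    by (simp add: u_def fps_tan_def fps_divide_unit)
  have u': "fps_deriv u = 1 + u + fps_const (1 / 2) * u\<^sup>2"
  proof -
    have "2 * fps_deriv u = 1 + (u + 1)\<^sup>2"
      using fps_deriv_sec_add_tan[where 'a = rat] by (simp add: u_def)
    also have "\<dots> = 2 * (1 + u) + u\<^sup>2"
      by (simp add: power2_eq_square algebra_simps)
    also have "u\<^sup>2 = 2 * (fps_const (1 / 2) * u\<^sup>2)"
      by (simp add: numeral_fps_const flip: mult.assoc)
    finally have "2 * fps_deriv u = 2 * (1 + u + fps_const (1 / 2) * u\<^sup>2)"
      by (simp only: distrib_left)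
    then show ?thesis
      by (rule mult_left_cancel[THEN iffD1, rotated]) simp
  qed
  have u1: "u $ 1 = 1"
    using arg_cong[OF u', of "\<lambda>f. f $ 0"] by (simp add: u0 fps_power_zeroth)
  have p0: "p n $ 0 = 1" for n
    unfolding p_def using u0 u1 by (rule ogf_power_nth_0)
  have rec: "p (Suc n) = p n + of_nat (n + 1) * fps_X * p (Suc n) + of_nat c * fps_X\<^sup>2 * p (n + 2)"
    if "2 * c = (n + 1) * (n + 2)" for n c
    unfolding p_def using u0 u' that by (rule ogf_power_recurrence)
  define W where "W k r = (let n = 4 * k in
      if r = 0 then p n
      else if r = 1 then p n + of_nat (n + 1) * fps_X * p (n + 1)
      else if r = 2 then p (n + 1)
      else if r = 3 then p (n + 2)
      else if r = 4 then p (n + 3)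
      else p (n + 3) + of_nat (2 * k + 2) * fps_X * p (n + 4))" for k r :: nat
  define V where "V i = W (i div 6) (i mod 6)" for i
  have V_W: "V (6*k+r) = W k r" if "r < 6" for k r
    using that by (simp add: V_def)
  \<comment> \<open>The last two entries belong to the next block; the recurrence reaches them from
    \<open>6*k+4\<close> and \<open>6*k+5\<close>.\<close>
  have V: "V (6*k) = p (4*k)"
    "V (6*k+1) = p (4*k) + of_nat (4*k+1) * fps_X * p (4*k+1)"
    "V (6*k+2) = p (4*k+1)" "V (6*k+3) = p (4*k+2)" "V (6*k+4) = p (4*k+3)"
    "V (6*k+5) = p (4*k+3) + of_nat (2*k+2) * fps_X * p (4*k+4)"
    "V (6*k+6) = p (4*k+4)"
    "V (6*k+7) = p (4*k+4) + of_nat (4*k+5) * fps_X * p (4*k+5)" for k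
    using V_W[of 0 k] V_W[of 1 k] V_W[of 2 k] V_W[of 3 k] V_W[of 4 k] V_W[of 5 k]
      V_W[of 0 "Suc k"] V_W[of 1 "Suc k"]
    by (simp_all add: W_def Let_def add_ac)
  \<comment> \<open>Shifted by one block, as these formulas are assumed only for
    \<open>k \<ge> 1\<close>.\<close>
  have ab: "a (6*k+6) = - of_nat (2*k+2) * X" "b (6*k+6) = 1" "a (6*k+7) = - of_nat (2*k+2) * X" for k
    using assms(3-5)[of "Suc k"] by (simp_all add: algebra_simps)
  note ab = ab assms(6-14)
  note poly_simps = fps_of_poly_uminus fps_of_poly_mult fps_of_poly_diff fps_of_poly_power fps_of_poly_1 fps_of_poly_fps_X
  have fps_of_poly_of_nat: "fps_of_poly (of_nat m) = (of_nat m :: rat fps)" for m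
    by (simp add: of_nat_poly fps_of_poly_const fps_of_nat)
  have cases6: "P i" if "\<And>k. P (6*k)" "\<And>k. P (6*k+1)" "\<And>k. P (6*k+2)"
      "\<And>k. P (6*k+3)" "\<And>k. P (6*k+4)" "\<And>k. P (6*k+5)" for P :: "nat \<Rightarrow> bool" and i
  proof -
    have "i = 6 * (i div 6) \<or> i = 6 * (i div 6) + 1 \<or> i = 6 * (i div 6) + 2 \<or>
        i = 6 * (i div 6) + 3 \<or> i = 6 * (i div 6) + 4 \<or> i = 6 * (i div 6) + 5"
      by presburger
    then show ?thesis
      using that by metis
  qed
  have index_sums: "m + 1 + 1 = m + 2" "m + 1 + 2 = m + 3" "m + 2 + 1 = m + 3" "m + 2 + 2 = m + 4"
    "m + 3 + 1 = m + 4" "m + 3 + 2 = m + 5" "m + 4 + 1 = m + 5" "m + 4 + 2 = m + 6"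
    "m + 5 + 1 = m + 6" "m + 5 + 2 = m + 7" for m :: nat
    by simp_all
  \<comment> \<open>Cases 1 and 5 merely unfold \<open>V\<close>; the others are \<open>rec\<close>
    at \<open>4*k\<close> up to \<open>4*k+3\<close>. In case 4 the quadratic coefficient splits as
    (4k+3)x times (2k+2)x, and in case 6 half of the linear term (4k+4)x moves to the other side,
    which explains the shape of \<open>V (6*k+5)\<close>.\<close>
  have V_rec: "V i = fps_of_poly (b (i + 1)) * V (i + 1) + fps_of_poly (a (i + 2)) * V (i + 2)" for i
  proof (induction i rule: cases6)
    case (1 k)
    show ?case
      unfolding index_sums ab V poly_simps fps_of_poly_of_nat
      by (simp add: algebra_simps)
  next
    case (2 k)
    show ?case
      using rec[of "(4*k+1) * (2*k+1)" "4*k"]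
      unfolding index_sums ab V poly_simps fps_of_poly_of_nat
      by (simp add: algebra_simps numeral_eq_Suc)
  next
    case (3 k)
    show ?case
      using rec[of "(4*k+3) * (2*k+1)" "4*k+1"]
      unfolding index_sums ab V poly_simps fps_of_poly_of_nat
      by (simp add: algebra_simps numeral_eq_Suc)
  next
    case (4 k)
    show ?case
      using rec[of "(4*k+3) * (2*k+2)" "4*k+2"]
      unfolding index_sums ab V poly_simps fps_of_poly_of_nat
      by (simp add: algebra_simps numeral_eq_Suc)
  next
    case (5 k)
    show ?case
      unfolding index_sums ab V poly_simps fps_of_poly_of_nat
      by (simp add: algebra_simps)
  next
    case (6 k)
    show ?case
      using rec[of "(2*k+2) * (4*k+5)" "4*k+3"]
      unfolding index_sums ab V poly_simps fps_of_poly_of_nat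
      by (simp add: algebra_simps numeral_eq_Suc)
  qed
  have V0: "V i $ 0 = 1" for i
    by (induction i rule: cases6; unfold V) (simp_all add: p0)
  have a0: "coeff (a (i + 2)) 0 = 0" for i
    by (induction i rule: cases6; unfold index_sums ab) (simp_all add: coeff_mult_0 power2_eq_square)
  have "has_cfrac (fps_of_poly (b 0) + fps_of_poly (a 1) * (V 1 / V 0)) a b"
  proof (rule has_cfrac_three_term)
    show "V i = fps_of_poly (b (Suc i)) * V (Suc i) + fps_of_poly (a (Suc (Suc i))) * V (Suc (Suc i))" for i
      using V_rec[of i] by simp
    show "coeff (a (Suc (Suc i))) 0 = 0" for i
      using a0[of i] by simp
  qed (rule V0)
  also have "fps_of_poly (b 0) + fps_of_poly (a 1) * (V 1 / V 0) = 1 + fps_X * p 1"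
    using V(1,2)[of 0] unfolding assms(1,2) by (simp add: p_def)
  \<comment> \<open>The summand 1 restores the constant term that was subtracted in
    \<open>u\<close>.\<close>
  also have "1 + fps_X * p 1 = Abs_fps euler_number"
  proof (rule fps_ext)
    fix n
    show "(1 + fps_X * p 1) $ n = Abs_fps euler_number $ n"
      using u0 by (cases n) (simp_all add: p_def ogf_power_def euler_number_def u_def)
  qed
  finally show "has_cfrac (Abs_fps euler_number) a b" .
  have upt: "[1..<10] = [1, 2, 3, 4, 5, 6, 7, 8, 9 :: nat]" "[0..<10] = [0, 1, 2, 3, 4, 5, 6, 7, 8, 9 :: nat]"
    by (simp_all add: upt_rec)
  show "map a [1..<10] = [1, - X, - (X^2), - 3 * X^2, - 3 * X, - 2 * X, - 2 * X, - 5 * X, - 15 * X^2]"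
    unfolding upt using assms(1) ab(1,3,5,7,9,11)[of 0, unfolded mult_0_right add_0] ab(5,7)[of 1] by simp
  show "map b [0..<10] = [0, 1, 1, 1 - 2 * X, 1, 1, 1, 1, 1, 1 - 6 * X]"
    unfolding upt using assms(2) ab(2,4,6,8,10,12)[of 0, unfolded mult_0_right add_0] ab(4,6,8)[of 1] by simp
qed

end
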